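(* Let $\mathcal{A}$ be a complex Banach $*$-algebra with identity. Let $a,b\in\mathcal{A}$ be EP elements such that $ab^{\pi}$ and $ba^{\pi}$ are core invertible and $aba^{\pi}=bab^{\pi}=0$. Then the following are equivalent: (1) $a+b$ is core invertible and $a(a+b)^{\mathrm{core}}a^{\pi}=ba^{\pi}(a+b)^{\mathrm{core}}b^{\pi}=b(a+b)^{\mathrm{core}}b^{\pi}=0$. (2) $aa^{\#}b+bb^{\#}a$ is core invertible and $a^{\pi}b^{\pi}a=b^{\pi}a^{\pi}b=0$.
   Context: An involution on a Banach algebra $\mathcal{A}$ is a map $*:\mathcal{A}\to\mathcal{A}$ with $(x+y)^*=x^*+y^*$, $(xy)^*=y^*x^*$, $(x^* )^*=x$ for all $x,y$; a Banach algebra with an involution is called a Banach $*$-algebra. An element $a\in\mathcal{A}$ is group invertible if there is $x\in\mathcal{A}$ with $axa=a$, $xax=x$, $ax=xa$; such $x$ is unique and is denoted $a^{\#}$, and then $a^{\pi}:=1-aa^{\#}$. An element $a$ is core invertible if there is $x\in\mathcal{A}$ with $xa^2=a$, $ax^2=x$, $(ax)^*=ax$; such $x$ is unique and is denoted $a^{\mathrm{core}}$. An element $a$ is EP if there is $x\in\mathcal{A}$ with $xa^2=a$, $ax=xa$, $(ax)^*=ax$. Every core invertible element and every EP element is group invertible, so $a^{\#}$ and $a^{\pi}$ make sense for such $a$. *)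

theory Defs
  imports Complex_Main
begin

text \<open>
  A complex Banach algebra with identity. The norm of the identity is not normalised, and
  \<open>monoid_mult\<close> is used in place of \<open>ring_1\<close> so that the zero algebra is not excluded.
  The real scalar multiplication of \<open>real_normed_algebra\<close> is tied to the complex one by
  \<open>scaleR_scaleC\<close>.
\<close>

class complex_banach_algebra = real_normed_algebra + monoid_mult + banach +
  fixes scaleC :: "complex \<Rightarrow> 'a \<Rightarrow> 'a"  (infixr \<open>*\<^sub>C\<close> 75)
  assumes scaleC_add_right: "c *\<^sub>C (x + y) = c *\<^sub>C x + c *\<^sub>C y"
    and scaleC_add_left: "(c + d) *\<^sub>C x = c *\<^sub>C x + d *\<^sub>C x"
    and scaleC_scaleC: "c *\<^sub>C d *\<^sub>C x = (c * d) *\<^sub>C x"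
    and scaleC_one: "1 *\<^sub>C x = x"
    and scaleR_scaleC: "r *\<^sub>R x = complex_of_real r *\<^sub>C x"
    and mult_scaleC_left: "(c *\<^sub>C x) * y = c *\<^sub>C (x * y)"
    and mult_scaleC_right: "x * (c *\<^sub>C y) = c *\<^sub>C (x * y)"
    and norm_scaleC: "norm (c *\<^sub>C x) = cmod c * norm x"

text \<open>
  The involution is only required to be an additive, anti-multiplicative map of period two:
  neither conjugate-linearity nor continuity is assumed.
\<close>

class complex_banach_star_algebra = complex_banach_algebra +
  fixes star :: "'a \<Rightarrow> 'a"  (\<open>(_\<^sup>\<star>)\<close> [1000] 999)
  assumes star_add: "(x + y)\<^sup>\<star> = x\<^sup>\<star> + y\<^sup>\<star>"
    and star_mult: "(x * y)\<^sup>\<star> = y\<^sup>\<star> * x\<^sup>\<star>"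
    and star_star: "(x\<^sup>\<star>)\<^sup>\<star> = x"

definition is_group_inverse :: "'a::monoid_mult \<Rightarrow> 'a \<Rightarrow> bool" where
  "is_group_inverse a x \<longleftrightarrow> a * x * a = a \<and> x * a * x = x \<and> a * x = x * a"

definition group_invertible :: "'a::monoid_mult \<Rightarrow> bool" where
  "group_invertible a \<longleftrightarrow> (\<exists>x. is_group_inverse a x)"

definition group_inv :: "'a::monoid_mult \<Rightarrow> 'a"  (\<open>(_\<^sup>#)\<close> [1000] 999) where
  "a\<^sup># = (THE x. is_group_inverse a x)"

definition spectral_idem :: "'a::{ring, monoid_mult} \<Rightarrow> 'a"  (\<open>(_\<^sup>\<pi>)\<close> [1000] 999) where
  "a\<^sup>\<pi> = 1 - a * a\<^sup>#"

definition is_core_inverse :: "'a::complex_banach_star_algebra \<Rightarrow> 'a \<Rightarrow> bool" where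
  "is_core_inverse a x \<longleftrightarrow> x * a ^ 2 = a \<and> a * x ^ 2 = x \<and> (a * x)\<^sup>\<star> = a * x"

definition core_invertible :: "'a::complex_banach_star_algebra \<Rightarrow> bool" where
  "core_invertible a \<longleftrightarrow> (\<exists>x. is_core_inverse a x)"

definition core_inv :: "'a::complex_banach_star_algebra \<Rightarrow> 'a" where
  "core_inv a = (THE x. is_core_inverse a x)"

definition EP :: "'a::complex_banach_star_algebra \<Rightarrow> bool" where
  "EP a \<longleftrightarrow> (\<exists>x. x * a ^ 2 = a \<and> a * x = x * a \<and> (a * x)\<^sup>\<star> = a * x)"

text \<open>
  The definite descriptions above are well defined, and the group inverses of core invertible
  and of EP elements exist.
\<close>

lemma is_group_inverse_unique:
  assumes "is_group_inverse a x" and "is_group_inverse a y"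
  shows "x = y"
proof -
  have x: "a * x * a = a" "x * a * x = x" "a * x = x * a"
    and y: "a * y * a = a" "y * a * y = y" "a * y = y * a"
    using assms by (auto simp: is_group_inverse_def)
  have "x = x * (a * y * a) * x" using x y by simp
  also have "\<dots> = x * a * y * (a * x)" by (simp add: mult.assoc)
  also have "\<dots> = x * (y * a) * (x * a)" using x(3) y(3) by (simp add: mult.assoc)
  also have "\<dots> = x * y * (a * x * a)" by (simp add: mult.assoc)
  also have "\<dots> = x * (y * a)" using x(1) by (simp add: mult.assoc)
  also have "\<dots> = x * a * y" using y(3) by (simp add: mult.assoc)
  finally have 1: "x = x * a * y" .
  have "y = y * a * y" using y by simp
  also have "\<dots> = (a * y) * y" using y(3) by simp
  also have "\<dots> = (a * x * a) * y * y" using x(1) by simp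
  also have "\<dots> = x * a * (a * y) * y" using x(3) by (simp add: mult.assoc)
  also have "\<dots> = x * a * (y * a * y)" using y(3) by (simp add: mult.assoc)
  also have "\<dots> = x * a * y" using y(2) by simp
  finally show ?thesis using 1 by simp
qed

lemma group_inv_eqI: "is_group_inverse a x \<Longrightarrow> a\<^sup># = x"
  unfolding group_inv_def by (blast intro: is_group_inverse_unique)

lemma is_group_inverse_group_inv: "group_invertible a \<Longrightarrow> is_group_inverse a (a\<^sup>#)"
  by (auto simp: group_invertible_def group_inv_eqI)

lemma is_core_inverse_inner_outer:
  assumes "is_core_inverse a x"
  shows "a * x * a = a" and "x * a * x = x"
proof -
  have x: "x * a ^ 2 = a" "a * x ^ 2 = x"
    using assms by (auto simp: is_core_inverse_def)
  have "a * x * a = a * x * (x * a ^ 2)" using x by simp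
  also have "\<dots> = (a * x ^ 2) * a ^ 2" by (simp add: power2_eq_square mult.assoc)
  finally show "a * x * a = a" using x by simp
  have "x * a * x = x * a * (a * x ^ 2)" using x by simp
  also have "\<dots> = (x * a ^ 2) * x ^ 2" by (simp add: power2_eq_square mult.assoc)
  finally show "x * a * x = x" using x by simp
qed

lemma is_core_inverse_unique:
  assumes "is_core_inverse a x" and "is_core_inverse a y"
  shows "x = y"
proof -
  note x = is_core_inverse_inner_outer[OF assms(1)]
  note y = is_core_inverse_inner_outer[OF assms(2)]
  have s: "(a * x)\<^sup>\<star> = a * x" "(a * y)\<^sup>\<star> = a * y"
    and d: "x * a ^ 2 = a" "a * y ^ 2 = y"
    using assms by (auto simp: is_core_inverse_def)
  have "a * y = (a * x * a) * y" using x by simp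
  also have "\<dots> = (a * x) * (a * y)" by (simp add: mult.assoc)
  finally have 1: "a * y = (a * x) * (a * y)" .
  have "a * y = ((a * x) * (a * y))\<^sup>\<star>" using 1 s by simp
  also have "\<dots> = (a * y * a) * x" using s by (simp add: star_mult mult.assoc)
  finally have 2: "a * y = a * x" using y by simp
  have "x = x * (a * y)" using x 2 by (simp add: mult.assoc)
  also have "\<dots> = x * (a * (a * y ^ 2))" using d by simp
  also have "\<dots> = (x * a ^ 2) * y ^ 2" by (simp add: power2_eq_square mult.assoc)
  finally show ?thesis using d by simp
qed

lemma core_inv_eqI: "is_core_inverse a x \<Longrightarrow> core_inv a = x"
  unfolding core_inv_def by (blast intro: is_core_inverse_unique)

lemma is_core_inverse_core_inv: "core_invertible a \<Longrightarrow> is_core_inverse a (core_inv a)"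
  by (auto simp: core_invertible_def core_inv_eqI)

lemma core_invertible_imp_group_invertible:
  assumes "core_invertible a"
  shows "group_invertible a"
proof -
  obtain x where c: "is_core_inverse a x"
    using assms by (auto simp: core_invertible_def)
  have d: "x * (a * a) = a" "a * (x * x) = x"
    using c by (auto simp: is_core_inverse_def power2_eq_square)
  have l: "a * (x * x * a) = x * a" using d(2) by (metis mult.assoc)
  have r: "(x * x * a) * a = x * a" using d(1) by (simp add: mult.assoc)
  have "a * (x * x * a) * a = a" using l d(1) by (simp add: mult.assoc)
  moreover have "(x * x * a) * a * (x * x * a) = x * x * a"
    using r l by (metis mult.assoc)
  ultimately have "is_group_inverse a (x * x * a)"
    using l r by (simp add: is_group_inverse_def)
  then show ?thesis by (auto simp: group_invertible_def)
qed

lemma EP_imp_group_invertible: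
  assumes "EP a"
  shows "group_invertible a"
proof -
  obtain x where d: "x * (a * a) = a" and c: "a * x = x * a"
    using assms by (auto simp: EP_def power2_eq_square)
  have i: "a * x * a = a" using c d by (simp add: mult.assoc)
  have "is_group_inverse a (x * a * x)"
  proof -
    have "a * (x * a * x) = (a * x * a) * x" by (simp add: mult.assoc)
    then have l: "a * (x * a * x) = a * x" using i by simp
    have "(x * a * x) * a = x * (a * x * a)" by (simp add: mult.assoc)
    then have r: "(x * a * x) * a = a * x" using i c by simp
    have "x * a * x * a * (x * a * x) = a * x * (x * a * x)" using r by metis
    also have "\<dots> = x * a * (x * a * x)" using c by simp
    also have "\<dots> = x * (a * x * a) * x" by (simp add: mult.assoc)
    also have "\<dots> = x * a * x" using i by simp
    finally show ?thesis
      using l r i by (simp add: is_group_inverse_def)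
  qed
  then show ?thesis by (auto simp: group_invertible_def)
qed

end

theory Submission imports Defs begin

text \<open>
  Write \<open>p = a a\<^sup>#\<close> and \<open>q = b b\<^sup>#\<close>; both are self-adjoint idempotents, and the hypotheses say that
  \<open>p b (1 - p) = 0\<close> and \<open>q a (1 - q) = 0\<close>. If (2) holds, then \<open>p\<close> and \<open>q\<close> commute, and relative to \<open>e = p q\<close> the
  element \<open>a + b\<close> is lower triangular with corner \<open>s = p b + q a\<close> and with second diagonal entry
  \<open>a b\<^sup>\<pi> + b a\<^sup>\<pi>\<close>, which is invertible on \<open>p (1 - q) + q (1 - p)\<close>; hence the core inverse of \<open>a + b\<close> can be
  written down from that of \<open>s\<close>. Conversely, if (1) holds and \<open>x\<close> is the core inverse of \<open>a + b\<close>,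
  the self-adjoint idempotent \<open>(a + b) x\<close> is triangular, hence diagonal, with respect to both \<open>p\<close>
  and \<open>q\<close>. This forces the two product conditions of (2), and the \<open>e\<close>-corner of \<open>x\<close> is the core
  inverse of \<open>s\<close>.
\<close>

text \<open>Products are normalised to right-nested form, where a rule for \<open>x * y\<close> does
  not match inside \<open>x * (y * w)\<close>; this variant fires there.\<close>

lemma mult_reassoc:
  fixes x y z :: "'a::semigroup_mult"
  assumes "x * y = z"
  shows "x * (y * w) = z * w"
  using assms by (simp flip: mult.assoc)

lemma mult_reassoc3:
  fixes x y z :: "'a::semigroup_mult"
  assumes "x * (y * z) = t"
  shows "x * (y * (z * w)) = t * w"
  using assms by (simp flip: mult.assoc)

section \<open>Involution and self-adjoint idempotents\<close>

lemma star_zero [simp]: "(0::'a::complex_banach_star_algebra)\<^sup>\<star> = 0"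
  using star_add[of "0::'a" 0] by simp

lemma star_diff: "((x::'a::complex_banach_star_algebra) - y)\<^sup>\<star> = x\<^sup>\<star> - y\<^sup>\<star>"
  using star_add[of "x - y" y] by simp

lemma star_one [simp]: "(1::'a::complex_banach_star_algebra)\<^sup>\<star> = 1"
  using star_mult[of "1\<^sup>\<star>" "1::'a"] by (simp add: star_star)

text \<open>Since \<open>p * r * p\<close> is self-adjoint, \<open>p * r\<close> equals its own
  adjoint \<open>r * p\<close>.\<close>

lemma self_adjoint_triangular_commute:
  fixes p r :: "'a::complex_banach_star_algebra"
  assumes "p\<^sup>\<star> = p" and "r\<^sup>\<star> = r" and "p * r * p = p * r"
  shows "p * r = r * p"
proof -
  have "(p * r * p)\<^sup>\<star> = (p * r)\<^sup>\<star>" using assms(3) by simp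
  then have "p * r * p = r * p" using assms(1,2) by (simp add: star_mult mult.assoc)
  with assms(3) show ?thesis by simp
qed

text \<open>An EP witness \<open>x\<close> need not be \<open>a\<^sup>#\<close>, but
  \<open>a * x = a * a\<^sup>#\<close> always holds.\<close>

lemma EP_group_inv_self_adjoint:
  fixes a :: "'a::complex_banach_star_algebra"
  assumes "EP a"
  shows "(a * a\<^sup>#)\<^sup>\<star> = a * a\<^sup>#"
proof -
  obtain x where x: "x * a ^ 2 = a" "a * x = x * a" "(a * x)\<^sup>\<star> = a * x"
    using assms by (auto simp: EP_def)
  have 1: "a * a\<^sup># * a = a" "a * a\<^sup># = a\<^sup># * a"
    using is_group_inverse_group_inv[OF EP_imp_group_invertible[OF assms]]
    by (auto simp: is_group_inverse_def)
  have 2: "a * x * a = a"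
    using x by (simp add: power2_eq_square mult.assoc)
  have "a * a\<^sup># = x * a * (a * a\<^sup>#)"
    using 2 x(2) by (simp flip: mult.assoc)
  also have "\<dots> = x * (a * a\<^sup># * a)" by (metis 1 mult.assoc)
  finally have "a * a\<^sup># = a * x" using 1(1) x(2) by simp
  with x(3) show ?thesis by simp
qed

section \<open>Corners and triangular decompositions\<close>

text \<open>With \<open>d = a * q'\<close>, the identity \<open>d = d * d * D\<close> gives
  \<open>A * d = A * d * d * D\<close>, and \<open>q' * d = d\<close> yields
  \<open>A * d * d = d\<close>.\<close>

lemma group_inv_corner:
  fixes a A d D q' :: "'a::{ring,monoid_mult}"
  assumes A: "is_group_inverse a A" and D: "is_group_inverse (a * q') D"
    and q: "q' * (a * q') = a * q'"
  shows "a * q' * D = a * A * q'"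
proof -
  let ?d = "a * q'"
  have 1: "a * A * a = a" "a * A = A * a" using A by (auto simp: is_group_inverse_def)
  have 2: "?d * D * ?d = ?d" "?d * D = D * ?d" using D by (auto simp: is_group_inverse_def)
  have 3: "?d = ?d * ?d * D" using 2 by (metis mult.assoc)
  have "a * A * q' = A * ?d" using 1 by (simp add: mult.assoc)
  also have "\<dots> = A * (?d * ?d * D)" using 3 by simp
  also have "\<dots> = (a * A) * (q' * ?d) * D" by (metis 1(2) mult.assoc)
  also have "\<dots> = (a * A * a) * q' * D" unfolding q by (simp add: mult.assoc)
  finally show ?thesis using 1 by simp
qed

text \<open>Triangularity gives \<open>e * m * e * (e * x * e) = e * (m * x)\<close>, so compression
  respects the defining products; \<open>e * (m * x)\<close> is self-adjoint because it equals
  \<open>e * (m * x) * e\<close>.\<close>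

lemma core_inverse_corner:
  fixes e m x :: "'a::complex_banach_star_algebra"
  assumes e: "e * e = e" "e\<^sup>\<star> = e" and m: "e * m * e = e * m" and x: "e * x * e = e * x"
    and c: "is_core_inverse m x"
  shows "is_core_inverse (e * m * e) (e * x * e)"
proof -
  have c1: "x * (m * m) = m" and c2: "m * (x * x) = x" and c3: "(m * x)\<^sup>\<star> = m * x"
    using c by (auto simp: is_core_inverse_def power2_eq_square)
  have r2: "e * (m * e) = e * m" "e * (x * e) = e * x" using m x by (simp_all add: mult.assoc)
  note r1 = e(1) c1 c2
  note r = r1 r1[THEN mult_reassoc] r2 r2[THEN mult_reassoc3]
  have mx: "e * m * e * (e * x * e) = e * (m * x)" by (simp add: r mult.assoc)
  have "e * (m * x) * e = e * (m * x)"
    using r2 r2[THEN mult_reassoc3] by (metis mult.assoc)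
  then have "(e * (m * x))\<^sup>\<star> = e * (m * x)"
    by (metis c3 e(2) star_mult mult.assoc)
  then show ?thesis
    unfolding is_core_inverse_def power2_eq_square mx by (simp add: r mult.assoc)
qed

text \<open>On the left, use \<open>x = s * (x * x)\<close>. On the right, use
  \<open>x = x * (s * x)\<close> and the adjoint of \<open>k * (s * x) = 0\<close>.\<close>

lemma core_inverse_annihilate:
  fixes k s x :: "'a::complex_banach_star_algebra"
  assumes c: "is_core_inverse s x" and k: "k\<^sup>\<star> = k" "k * s = 0"
  shows "k * x = 0" and "x * k = 0"
proof -
  have c: "s * (x * x) = x" "(s * x)\<^sup>\<star> = s * x" "x * (s * x) = x"
    using c is_core_inverse_inner_outer(2)[OF c]
    by (auto simp: is_core_inverse_def power2_eq_square mult.assoc)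
  show "k * x = 0" using k(2) c(1) by (metis mult.assoc mult_zero_left)
  have "(k * (s * x))\<^sup>\<star> = 0" using k(2) by (simp flip: mult.assoc)
  then have "(s * x) * k = 0" using k(1) c(2) by (simp only: star_mult)
  then show "x * k = 0" using c(3) by (metis mult.assoc mult_zero_right)
qed

text \<open>The formula is that of the inverse of the block matrix with rows \<open>(s, 0)\<close> and \<open>(c, d)\<close>.\<close>

lemma core_inverse_triangular:
  fixes s x c d y k :: "'a::complex_banach_star_algebra"
  assumes sx: "is_core_inverse s x"
    and k: "k\<^sup>\<star> = k" "k * s = 0" "s * k = 0" "k * c = c" "c * k = 0"
    and d: "d * y = k" "y * d = k" "k * d = d" "d * k = d" "k * y = y" "y * k = y"
  shows "is_core_inverse (s + c + d) (x - y * c * x + y)"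
proof -
  have x: "x * (s * s) = s" "s * (x * x) = x" "(s * x)\<^sup>\<star> = s * x"
    using sx by (auto simp: is_core_inverse_def power2_eq_square)
  note kx = core_inverse_annihilate[OF sx k(1,2)]
  \<comment> \<open>Inserting \<open>k\<close> between the factors kills one of them.\<close>
  have z: "s * y = 0" "c * y = 0" "d * x = 0" "x * y = 0" "x * c = 0" "x * d = 0" "y * s = 0"
    "s * c = 0" "s * d = 0" "c * c = 0" "c * d = 0" "d * s = 0" "y * x = 0"
    using k d kx by (metis mult.assoc mult_zero_left mult_zero_right)+
  note r = x(1,2) kx z k(2-5) d
  note rr = r r[THEN mult_reassoc]
  \<comment> \<open>The cross terms cancel because \<open>d * y * c * x = k * c * x = c * x\<close>;
    what remains is a sum of two self-adjoint elements.\<close>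
  have 1: "(s + c + d) * (x - y * c * x + y) = s * x + k"
    by (simp add: algebra_simps rr)
  have 2: "(s * x + k) * (x - y * c * x + y) = x - y * c * x + y"
    by (simp add: algebra_simps rr)
  have 3: "(x - y * c * x + y) * (s + c + d) = x * s - y * c * x * s + y * c + k"
    by (simp add: algebra_simps rr)
  have 4: "(x * s - y * c * x * s + y * c + k) * (s + c + d) = s + c + d"
    by (simp add: algebra_simps rr)
  show ?thesis
    unfolding is_core_inverse_def power2_eq_square
    using 2 4 k(1) x(3) by (simp add: 1 3 star_add flip: mult.assoc)
qed

section \<open>Idempotents attached to EP elements\<close>

lemma EP_projection:
  fixes a :: "'a::complex_banach_star_algebra"
  assumes "EP a"
  defines "p \<equiv> a * a\<^sup>#"
  shows "p\<^sup>\<star> = p" and "p * p = p" and "p * a = a" and "a * p = a" and "a\<^sup># * a = p"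
    and "a\<^sup>\<pi> = 1 - p"
proof -
  have "a * a\<^sup># * a = a" "a * a\<^sup># = a\<^sup># * a"
    using is_group_inverse_group_inv[OF EP_imp_group_invertible[OF assms(1)]]
    by (auto simp: is_group_inverse_def)
  then show "p * p = p" "p * a = a" "a * p = a" "a\<^sup># * a = p"
    unfolding p_def by (metis mult.assoc)+
  show "p\<^sup>\<star> = p" unfolding p_def by (rule EP_group_inv_self_adjoint[OF assms(1)])
  show "a\<^sup>\<pi> = 1 - p" by (simp add: spectral_idem_def p_def)
qed

lemma EP_cancel_left:
  fixes a :: "'a::complex_banach_star_algebra"
  assumes "EP a" and "a * z = 0"
  shows "a * a\<^sup># * z = 0"
  using EP_projection(5)[OF assms(1)] assms(2) by (metis mult.assoc mult_zero_right)

text \<open>The idempotent \<open>r = (a + b) * x\<close> commutes with \<open>p\<close>, hence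
  fixes \<open>(1 - p) * b\<close>; but \<open>(1 - q) * r * (1 - p) = 0\<close>, so
  \<open>1 - q\<close> kills that element.\<close>

lemma triangular_core_inverse_orthogonal:
  fixes a b x :: "'a::complex_banach_star_algebra"
  assumes a: "EP a" and b: "EP b" and ab: "a * b * a\<^sup>\<pi> = 0"
    and x: "is_core_inverse (a + b) x" and ax: "a * x * a\<^sup>\<pi> = 0"
  shows "b\<^sup>\<pi> * a\<^sup>\<pi> * b = 0"
proof -
  define p q where "p = a * a\<^sup>#" and "q = b * b\<^sup>#"
  note P = EP_projection[OF a, folded p_def] and Q = EP_projection[OF b, folded q_def]
  have pb: "p * (b * p) = p * b" and px: "p * (x * p) = p * x"
    using EP_cancel_left[OF a, of "b * a\<^sup>\<pi>"] EP_cancel_left[OF a, of "x * a\<^sup>\<pi>"] ab ax P(6)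
    by (simp_all add: p_def[symmetric] algebra_simps)
  define r where "r = (a + b) * x"
  have r: "r\<^sup>\<star> = r" "r * (a + b) = a + b"
    using x is_core_inverse_inner_outer(1)[OF x] by (auto simp: r_def is_core_inverse_def)
  have prp: "p * (r * p) = p * r"
  proof -
    \<comment> \<open>By \<open>p * b = p * b * p\<close>, a \<open>p\<close> can be inserted before
      \<open>x\<close>, and it then absorbs the \<open>p\<close> after \<open>x\<close>.\<close>
    have "p * (b * (x * p)) = p * (b * (p * (x * p)))"
      by (simp only: mult_reassoc3[OF pb] mult.assoc)
    also have "\<dots> = p * (b * x)" by (simp only: px mult_reassoc3[OF pb] mult.assoc)
    finally have 1: "p * (b * (x * p)) = p * (b * x)" .
    have "a * (x * p) = a * (p * (x * p))" by (simp only: mult_reassoc[OF P(4)])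
    also have "\<dots> = a * x" by (simp only: px mult_reassoc[OF P(4)])
    finally show ?thesis using 1 by (simp add: r_def algebra_simps mult_reassoc[OF P(3)])
  qed
  have comm: "p * r = r * p"
    by (rule self_adjoint_triangular_commute) (use P r prp in \<open>simp_all add: mult.assoc\<close>)
  have "(1 - p) * r * a = r * a - r * (p * a)" by (simp add: comm left_diff_distrib mult.assoc)
  then have ra: "(1 - p) * r * a = 0" using P(3) by simp
  have "r * (1 - p) * b = (1 - p) * r * b" by (simp add: comm algebra_simps)
  also have "\<dots> = (1 - p) * (r * (a + b))"
    using ra by (simp add: distrib_left mult.assoc)
  also have "\<dots> = (1 - p) * b" unfolding r(2) by (simp add: P(3) algebra_simps)
  finally have rb: "r * (1 - p) * b = (1 - p) * b" .
  have xp: "x * (1 - p) = (1 - p) * (x * (1 - p))" using px by (simp add: algebra_simps)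
  \<comment> \<open>\<open>1 - q\<close> kills \<open>b\<close> from the left, \<open>1 - p\<close>
    kills \<open>a\<close> from the right; \<open>xp\<close> carries this over to
    \<open>r\<close>.\<close>
  have "(1 - q) * (a + b) * (1 - p) = 0"
    by (simp add: algebra_simps P(4) Q(3) mult_reassoc[OF P(4)] mult_reassoc[OF Q(3)])
  then have "(1 - q) * r * (1 - p) = 0"
    unfolding r_def by (metis xp mult.assoc mult_zero_left)
  then have "(1 - q) * (r * (1 - p) * b) = 0" by (simp flip: mult.assoc)
  then show ?thesis unfolding rb P(6) Q(6) by (simp add: mult.assoc)
qed

text \<open>The hypothesis reduces to \<open>q * p = p * q * p\<close>, whose right side is
  self-adjoint.\<close>

lemma EP_projections_commute:
  fixes a b :: "'a::complex_banach_star_algebra"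
  assumes a: "EP a" and b: "EP b" and c: "a\<^sup>\<pi> * b\<^sup>\<pi> * a = 0"
  shows "b * b\<^sup># * (a * a\<^sup>#) = a * a\<^sup># * (b * b\<^sup>#)"
proof -
  define p q where "p = a * a\<^sup>#" and "q = b * b\<^sup>#"
  note P = EP_projection[OF a, folded p_def] and Q = EP_projection[OF b, folded q_def]
  have "a\<^sup>\<pi> * b\<^sup>\<pi> * p = 0" using c by (simp add: p_def flip: mult.assoc)
  then have qp: "p * (q * p) = q * p" using P(2,6) Q(6) by (simp add: algebra_simps)
  then have "(p * (q * p))\<^sup>\<star> = (q * p)\<^sup>\<star>" by simp
  then have "p * (q * p) = p * q" using P(1) Q(1) by (simp add: star_mult mult.assoc)
  with qp show ?thesis unfolding p_def q_def by simp
qed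

section \<open>Core inverses in the presence of commuting idempotents\<close>

locale commuting_EP_pair =
  fixes a b p q :: "'a::complex_banach_star_algebra"
  assumes a: "EP a" and b: "EP b"
    and ab: "a * b * a\<^sup>\<pi> = 0" and ba: "b * a * b\<^sup>\<pi> = 0"
    and p: "p = a * a\<^sup>#" and q: "q = b * b\<^sup>#"
    and comm: "q * p = p * q"
begin

lemmas P = EP_projection[OF a, folded p] and Q = EP_projection[OF b, folded q]

lemma pbp: "p * (b * p) = p * b" and qaq: "q * (a * q) = q * a"
  using EP_cancel_left[OF a, of "b * a\<^sup>\<pi>"] EP_cancel_left[OF b, of "a * b\<^sup>\<pi>"] ab ba P(6) Q(6)
  by (simp_all add: p[symmetric] q[symmetric] algebra_simps)

lemma pqa: "p * (q * a) = q * a" and bpq: "b * (p * q) = b * p"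
  using comm P(3) Q(4) by (metis mult.assoc)+

text \<open>A rewriting system for words in \<open>a\<close>, \<open>b\<close>, \<open>p\<close>,
  \<open>q\<close>: each rule shortens the word or moves \<open>p\<close> in front of
  \<open>q\<close>.\<close>

lemmas base = P(2-4) Q(2-4) comm
lemmas base3 = pbp qaq pqa bpq
lemmas normalize = base base[THEN mult_reassoc] base3 base3[THEN mult_reassoc3]

text \<open>\<open>p * b + q * a\<close> is the compression of \<open>a + b\<close> to
  \<open>p * q\<close>, and \<open>x\<close> is triangular for \<open>p * q\<close> because it is so
  for \<open>p\<close> and for \<open>q\<close>.\<close>

lemma corner_core_inverse:
  assumes x: "is_core_inverse (a + b) x" and ax: "a * x * a\<^sup>\<pi> = 0" and bx: "b * x * b\<^sup>\<pi> = 0"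
  shows "is_core_inverse (p * b + q * a) (p * q * x * (p * q))"
proof -
  have px: "p * (x * p) = p * x" and qx: "q * (x * q) = q * x"
    using EP_cancel_left[OF a, of "x * a\<^sup>\<pi>"] EP_cancel_left[OF b, of "x * b\<^sup>\<pi>"] ax bx P(6) Q(6)
    by (simp_all add: p[symmetric] q[symmetric] algebra_simps)
  have "p * q * (p * q) = p * q" by (simp add: normalize algebra_simps)
  moreover have "(p * q)\<^sup>\<star> = p * q" using P(1) Q(1) comm by (simp add: star_mult)
  moreover have "p * q * (a + b) * (p * q) = p * b + q * a"
    by (simp add: normalize algebra_simps)
  moreover have "p * q * (a + b) = p * b + q * a"
    by (simp add: normalize algebra_simps)
  moreover have "p * q * x * (p * q) = p * q * x"
    using px qx comm by (metis mult.assoc)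
  ultimately show ?thesis using core_inverse_corner[of "p * q" "a + b" x] x by metis
qed

lemma sum_core_inverse:
  assumes x: "is_core_inverse (p * b + q * a) x"
    and d1: "core_invertible (a * b\<^sup>\<pi>)" and d2: "core_invertible (b * a\<^sup>\<pi>)"
  obtains y where "is_core_inverse (a + b) y"
    and "a * y * a\<^sup>\<pi> = 0" and "b * a\<^sup>\<pi> * y * b\<^sup>\<pi> = 0" and "b * y * b\<^sup>\<pi> = 0"
proof -
  define D where "D = (a * b\<^sup>\<pi>)\<^sup>#"
  define E where "E = (b * a\<^sup>\<pi>)\<^sup>#"
  have D: "is_group_inverse (a * b\<^sup>\<pi>) D" and E: "is_group_inverse (b * a\<^sup>\<pi>) E"
    unfolding D_def E_def
    by (rule is_group_inverse_group_inv core_invertible_imp_group_invertible d1 d2)+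
  \<comment> \<open>The corner condition on \<open>1 - q\<close> is
    \<open>q * a * (1 - q) = 0\<close>.\<close>
  have dD: "a * b\<^sup>\<pi> * D = p * b\<^sup>\<pi>"
    unfolding p
    by (rule group_inv_corner[OF _ D])
      (use is_group_inverse_group_inv[OF EP_imp_group_invertible[OF a]] in
        \<open>simp_all add: Q(6) algebra_simps normalize\<close>)
  have dE: "b * a\<^sup>\<pi> * E = q * a\<^sup>\<pi>"
    unfolding q
    by (rule group_inv_corner[OF _ E])
      (use is_group_inverse_group_inv[OF EP_imp_group_invertible[OF b]] in
        \<open>simp_all add: P(6) algebra_simps normalize\<close>)
  have Dd: "D * (a * b\<^sup>\<pi>) = p * b\<^sup>\<pi>" "p * b\<^sup>\<pi> * D = D" "D * (p * b\<^sup>\<pi>) = D"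
    using D dD unfolding is_group_inverse_def by (metis mult.assoc)+
  have Ee: "E * (b * a\<^sup>\<pi>) = q * a\<^sup>\<pi>" "q * a\<^sup>\<pi> * E = E" "E * (q * a\<^sup>\<pi>) = E"
    using E dE unfolding is_group_inverse_def by (metis mult.assoc)+
  have Dz: "p * D = D" "q * D = 0" "D * p = D" "D * q = 0"
  proof -
    have "p * (p * b\<^sup>\<pi>) = p * b\<^sup>\<pi>" "q * (p * b\<^sup>\<pi>) = 0" "p * b\<^sup>\<pi> * p = p * b\<^sup>\<pi>" "p * b\<^sup>\<pi> * q = 0"
      by (simp_all add: Q(6) algebra_simps normalize)
    then show "p * D = D" "q * D = 0" "D * p = D" "D * q = 0"
      using Dd(2,3) by (metis mult.assoc mult_zero_left mult_zero_right)+
  qed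
  have Ez: "q * E = E" "p * E = 0" "E * q = E" "E * p = 0"
  proof -
    have "q * (q * a\<^sup>\<pi>) = q * a\<^sup>\<pi>" "p * (q * a\<^sup>\<pi>) = 0" "q * a\<^sup>\<pi> * q = q * a\<^sup>\<pi>" "q * a\<^sup>\<pi> * p = 0"
      by (simp_all add: P(6) algebra_simps normalize)
    then show "q * E = E" "p * E = 0" "E * q = E" "E * p = 0"
      using Ee(2,3) by (metis mult.assoc mult_zero_left mult_zero_right)+
  qed
  \<comment> \<open>\<open>D\<close> lives in the corner of \<open>p * (1 - q)\<close> and
    \<open>E\<close> in that of \<open>q * (1 - p)\<close>, so mixed products vanish.\<close>
  have z: "a * E = 0" "E * a = 0" "b * D = 0" "D * b = 0"
    using P(3,4) Q(3,4) Dz Ez by (metis mult.assoc mult_zero_left mult_zero_right)+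
  have aD: "a * D = p - p * q" and bE: "b * E = q - p * q"
    using dD dE by (simp_all add: P(6) Q(6) algebra_simps normalize Dz Ez)
  have Da: "D * (a * q) = D * a - p + p * q" and Eb: "E * (b * p) = E * b - q + p * q"
    using Dd(1) Ee(1) by (simp_all add: P(6) Q(6) algebra_simps normalize)
  note inv2 = Dz Ez z aD bE
  note inv = inv2 inv2[THEN mult_reassoc] Da Eb Da[THEN mult_reassoc3] Eb[THEN mult_reassoc3]
  \<comment> \<open>With \<open>m = a + b\<close> and \<open>e = p * q\<close>, the blocks are
    \<open>e * m\<close>, \<open>m * e - e * m\<close> and \<open>m * (1 - e)\<close>;
    \<open>D + E\<close> inverts \<open>?d\<close> relative to \<open>?k\<close>.\<close>
  let ?s = "p * b + q * a"
  let ?c = "a * q - q * a + (b * p - p * b)"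
  let ?d = "a * b\<^sup>\<pi> + b * a\<^sup>\<pi>"
  let ?k = "p * b\<^sup>\<pi> + q * a\<^sup>\<pi>"
  let ?y = "x - (D + E) * ?c * x + (D + E)"
  have "is_core_inverse (?s + ?c + ?d) ?y"
  proof (rule core_inverse_triangular[OF x, where k = ?k])
    show "?k\<^sup>\<star> = ?k"
      using P(1) Q(1) by (simp add: P(6) Q(6) algebra_simps star_add star_diff star_mult comm)
  qed (simp_all add: P(6) Q(6) algebra_simps normalize inv)
  moreover have "?s + ?c + ?d = a + b"
    by (simp add: P(6) Q(6) algebra_simps)
  ultimately have y: "is_core_inverse (a + b) ?y" by simp
  have pi: "(a\<^sup>\<pi>)\<^sup>\<star> = a\<^sup>\<pi>" "(b\<^sup>\<pi>)\<^sup>\<star> = b\<^sup>\<pi>"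
    "a\<^sup>\<pi> * (p * b + q * a) = 0" "b\<^sup>\<pi> * (p * b + q * a) = 0"
    using P(1) Q(1) by (simp_all add: P(6) Q(6) star_diff algebra_simps normalize)
  \<comment> \<open>Hence right multiplication by \<open>1 - p\<close> or \<open>1 - q\<close>
    leaves only the summand \<open>D + E\<close> of \<open>?y\<close>.\<close>
  have "x * p = x" "x * q = x"
    using core_inverse_annihilate(2)[OF x pi(1,3)] core_inverse_annihilate(2)[OF x pi(2,4)]
    by (simp_all add: P(6) Q(6) algebra_simps)
  note xz = this this[THEN mult_reassoc]
  show thesis
    by (rule that[OF y]) (simp_all add: P(6) Q(6) algebra_simps normalize inv xz)
qed

end

theorem theorem2p6:
  fixes a b :: "'a::complex_banach_star_algebra"
  assumes "EP a" and "EP b"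
    and "core_invertible (a * b\<^sup>\<pi>)" and "core_invertible (b * a\<^sup>\<pi>)"
    and "a * b * a\<^sup>\<pi> = 0" and "b * a * b\<^sup>\<pi> = 0"
  shows "(core_invertible (a + b) \<and>
          a * core_inv (a + b) * a\<^sup>\<pi> = 0 \<and>
          b * a\<^sup>\<pi> * core_inv (a + b) * b\<^sup>\<pi> = 0 \<and>
          b * core_inv (a + b) * b\<^sup>\<pi> = 0)
     \<longleftrightarrow> (core_invertible (a * a\<^sup># * b + b * b\<^sup># * a) \<and>
          a\<^sup>\<pi> * b\<^sup>\<pi> * a = 0 \<and> b\<^sup>\<pi> * a\<^sup>\<pi> * b = 0)"
    (is "?L \<longleftrightarrow> ?R")
proof
  assume L: ?L
  define x where "x = core_inv (a + b)"
  have x: "is_core_inverse (a + b) x" "a * x * a\<^sup>\<pi> = 0" "b * x * b\<^sup>\<pi> = 0"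
    using L by (auto simp: x_def is_core_inverse_core_inv)
  have R2: "b\<^sup>\<pi> * a\<^sup>\<pi> * b = 0"
    using triangular_core_inverse_orthogonal[OF assms(1,2,5)] x by blast
  have R1: "a\<^sup>\<pi> * b\<^sup>\<pi> * a = 0"
    using triangular_core_inverse_orthogonal[OF assms(2,1,6)] x by (simp add: add.commute)
  \<comment> \<open>The product condition \<open>R1\<close> makes the idempotents commute, so the
    corner of \<open>x\<close> is available.\<close>
  interpret commuting_EP_pair a b "a * a\<^sup>#" "b * b\<^sup>#"
    using assms EP_projections_commute[OF assms(1,2) R1] by unfold_locales simp_all
  show ?R using corner_core_inverse[OF x] R1 R2 by (auto simp: core_invertible_def)
next
  assume R: ?R
  interpret commuting_EP_pair a b "a * a\<^sup>#" "b * b\<^sup>#"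
    using assms EP_projections_commute[OF assms(1,2)] R by unfold_locales simp_all
  obtain x where x: "is_core_inverse (a * a\<^sup># * b + b * b\<^sup># * a) x"
    using R by (auto simp: core_invertible_def)
  obtain y where y: "is_core_inverse (a + b) y"
    and "a * y * a\<^sup>\<pi> = 0" "b * a\<^sup>\<pi> * y * b\<^sup>\<pi> = 0" "b * y * b\<^sup>\<pi> = 0"
    using sum_core_inverse[OF x assms(3,4)] .
  then show ?L using core_inv_eqI[OF y] by (auto simp only: core_invertible_def)
qed

end
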